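(* Let $(\mathcal{A}_n)_{n=1}^\infty$ be a sequence of algorithms approximating the solution $z$ of the initial value problem $z'(t)=f(t,z(t))$, $t\in[a,b]$, $z(a)=\eta$, such that $\mathcal{A}_n\in\Phi_n$ and, for each $(\eta,f)$ in a certain class $F$ and each $(\tilde\eta,\tilde f)\in V_{(\eta,f)}(\delta)$, the following bound for the approximation error holds with probability $1$ for each $n\in\mathbb{N}$, $n\ge n_0$ (with $h=\frac{b-a}{n}$): $$\sup_{a\le t\le b}\|z(t)-\mathcal{A}_n(t)\|\le C_1\max_{1\le k\le n}\Bigl\|\sum_{j=1}^kE_j(h)\Bigr\|+C_2h^\gamma+C_3\delta,$$ where (i) $(E_j(h))_{j=1}^n$ is an $(\mathcal{F}_j)_{j=1}^n$-adapted process; (ii) $\mathbb{E}\bigl(E_j(h)\,|\,\mathcal{F}_{j-1}\bigr)=0$ and $\|E_j(h)\|\le C_0h^{\gamma+1/2}$ with probability $1$ for all $j\in\{1,\ldots,n\}$; (iii) $C_0,C_1,C_2,C_3>0$ are constants which do not depend on $n$. Then there exist constants $c_1,c_2>0$, not dependent on $n$, such that for all $(\eta,f)\in F$, $(\tilde\eta,\tilde f)\in V_{(\eta,f)}(\delta)$, $n\in\mathbb{N}$, $n\ge n_0$, and for all $\xi\ge c_1$, the algorithm $\mathcal{A}_n$ satisfies $$\mathbb{P}\Bigl(\sup_{a\le t\le b}\|z(t)-\mathcal{A}_n(t)\|>\xi\max\{h^\gamma,\delta\}\Bigr)\le\exp(-c_2\xi^2).$$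
   Context: Here $-\infty<a<b<\infty$, $d\in\mathbb{Z}_+$, $\|x\|=\sum_{k=1}^d|x_k|$ is the one norm on $\mathbb{R}^d$, and $B(x,r)=\{y\in\mathbb{R}^d:\|y-x\|\le r\}$. $(\Omega,\Sigma,\mathbb{P})$ is a complete probability space and $\mathcal{N}=\{A\in\Sigma:\mathbb{P}(A)=0\}$. $F$ is a class of initial value problems $z'(t)=f(t,z(t))$, $t\in[a,b]$, $z(a)=\eta$, or equivalently of pairs $(\eta,f)$, with $\eta\in\mathbb{R}^d$ and $f:[a,b]\times\mathbb{R}^d\to\mathbb{R}^d$; $z$ denotes the solution. Noise: $\delta\in[0,1]$ is the precision (noise) parameter, and $\mathcal{K}(\delta)$ is a class of Borel measurable noise functions $\tilde\delta:[a,b]\times\mathbb{R}^d\to\mathbb{R}^d$, which may satisfy some additional assumptions (where $\delta$ can be a parameter). Put $V_f(\delta)=\{\tilde f:\ \tilde f=f+\tilde\delta_f\text{ for some }\tilde\delta_f\in\mathcal{K}(\delta)\}$ and $V_{(\eta,f)}(\delta)=B(\eta,\delta)\times V_f(\delta)$. Algorithms: for $(\tilde\eta,\tilde f)\in V_{(\eta,f)}(\delta)$, a vector of noisy information about $(\eta,f)$ based on $2i$ noisy evaluations of $f$ is any vector $$N(\tilde\eta,\tilde f)=[\tilde\eta,\tilde f(t_1,y_1),\ldots,\tilde f(t_i,y_i),\tilde f(\theta_1,z_1),\ldots,\tilde f(\theta_i,z_i)],$$ where $i\in\mathbb{N}$, $t_1,\ldots,t_i\in[a,b]$ are deterministic,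 $(\theta_1,\ldots,\theta_i)$ is a random vector on $(\Omega,\Sigma,\mathbb{P})$, $(y_1,z_1)=\psi_1(\tilde\eta)$, and $$(y_j,z_j)=\psi_j\bigl(\tilde f(t_1,y_1),\ldots,\tilde f(t_{j-1},y_{j-1}),\tilde f(\theta_1,z_1),\ldots,\tilde f(\theta_{j-1},z_{j-1}),\tilde\eta\bigr)$$ for Borel measurable maps $\psi_j:\mathbb{R}^{(2j-1)d}\to\mathbb{R}^d\times\mathbb{R}^d$, $j\in\{2,\ldots,i\}$. The filtration is $\mathcal{F}_0=\sigma(\mathcal{N})$ and $\mathcal{F}_j=\sigma\bigl(\sigma(\theta_1,\ldots,\theta_j)\cup\mathcal{N}\bigr)$ for $j\in\{1,\ldots,i\}$. For $n\in\mathbb{N}$, $\Phi_n$ is the class of algorithms computing the approximate solution using $N(\tilde\eta,\tilde f)$ based on at most $n$ noisy evaluations of $f$, i.e. of the form $\mathcal{A}(\tilde\eta,\tilde f,\delta)=\varphi(N(\tilde\eta,\tilde f))$, where $\varphi:\mathbb{R}^{(2i+1)d}\to D([a,b];\mathbb{R}^d)$ is Borel measurable and the Skorokhod space $D([a,b];\mathbb{R}^d)$ carries the Borel $\sigma$-field of the Skorokhod topology. $\mathcal{A}_n(t)$ denotes the value at $t$ of the random function produced by $\mathcal{A}_n$. *)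

theory Defs
  imports "HOL-Probability.Probability"
begin

definition one_norm :: "real ^ 'd \<Rightarrow> real" where
  "one_norm x = (\<Sum>k\<in>UNIV. \<bar>x $ k\<bar>)"

text \<open>Functions on \<open>[a,b] \<times> \<real>\<^sup>d\<close> are represented by total functions whose values at times
  outside \<open>[a,b]\<close> are never used.\<close>

type_synonym 'd rhs = "real \<times> (real ^ 'd) \<Rightarrow> real ^ 'd"

definition ivp_solution ::
    "real \<Rightarrow> real \<Rightarrow> (real ^ 'd) \<times> 'd rhs \<Rightarrow> (real \<Rightarrow> real ^ 'd) \<Rightarrow> bool" where
  "ivp_solution a b = (\<lambda>(\<eta>, f) z. z a = \<eta> \<and>
     (\<forall>t\<in>{a..b}. (z has_vector_derivative f (t, z t)) (at t within {a..b})))"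


subsection \<open>Noisy data\<close>

definition borel_rhs :: "real \<Rightarrow> real \<Rightarrow> ('d :: finite) rhs set" where
  "borel_rhs a b = borel_measurable (restrict_space borel ({a..b} \<times> UNIV))"

definition noisy_rhs :: "real \<Rightarrow> real \<Rightarrow> (real \<Rightarrow> ('d :: finite) rhs set) \<Rightarrow> real \<Rightarrow> 'd rhs \<Rightarrow> 'd rhs set" where
  "noisy_rhs a b K \<delta> f =
     {f'. \<exists>g\<in>K \<delta>. \<forall>t\<in>{a..b}. \<forall>y. f' (t, y) = f (t, y) + g (t, y)}"

definition noisy_data ::
    "real \<Rightarrow> real \<Rightarrow> (real \<Rightarrow> ('d :: finite) rhs set) \<Rightarrow> real \<Rightarrow> (real ^ 'd) \<times> 'd rhs \<Rightarrow> ((real ^ 'd) \<times> 'd rhs) set" where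
  "noisy_data a b K \<delta> = (\<lambda>(\<eta>, f). {\<eta>'. one_norm (\<eta>' - \<eta>) \<le> \<delta>} \<times> noisy_rhs a b K \<delta> f)"


subsection \<open>The Skorokhod space\<close>

definition skorokhod_space :: "real \<Rightarrow> real \<Rightarrow> (real \<Rightarrow> real ^ 'd) set" where
  "skorokhod_space a b = {x \<in> extensional {a..b}.
     (\<forall>t\<in>{a..<b}. (x \<longlongrightarrow> x t) (at_right t)) \<and>
     (\<forall>t\<in>{a<..b}. \<exists>l. (x \<longlongrightarrow> l) (at_left t))}"

definition time_change :: "real \<Rightarrow> real \<Rightarrow> (real \<Rightarrow> real) \<Rightarrow> bool" where
  "time_change a b \<tau> \<longleftrightarrow>
     strict_mono_on {a..b} \<tau> \<and> continuous_on {a..b} \<tau> \<and> \<tau> ` {a..b} = {a..b}"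

text \<open>The Skorokhod distance of \<open>x\<close> and \<open>y\<close> is the infimum of all \<open>e > 0\<close> with
  \<open>skorokhod_close a b e x y\<close>; the following topology is the one it induces.\<close>

definition skorokhod_close ::
    "real \<Rightarrow> real \<Rightarrow> real \<Rightarrow> (real \<Rightarrow> real ^ 'd) \<Rightarrow> (real \<Rightarrow> real ^ 'd) \<Rightarrow> bool" where
  "skorokhod_close a b e x y \<longleftrightarrow> (\<exists>\<tau>. time_change a b \<tau> \<and>
     (\<forall>t\<in>{a..b}. \<bar>\<tau> t - t\<bar> \<le> e \<and> one_norm (x t - y (\<tau> t)) \<le> e))"

definition skorokhod_open :: "real \<Rightarrow> real \<Rightarrow> (real \<Rightarrow> real ^ 'd) set \<Rightarrow> bool" where
  "skorokhod_open a b U \<longleftrightarrow> U \<subseteq> skorokhod_space a b \<and>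
     (\<forall>x\<in>U. \<exists>e>0. \<forall>y\<in>skorokhod_space a b. skorokhod_close a b e x y \<longrightarrow> y \<in> U)"

definition skorokhod_topology :: "real \<Rightarrow> real \<Rightarrow> (real \<Rightarrow> real ^ 'd) topology" where
  "skorokhod_topology a b = topology (skorokhod_open a b)"

lemma skorokhod_close_mono:
  "skorokhod_close a b e x y \<Longrightarrow> e \<le> e' \<Longrightarrow> skorokhod_close a b e' x y"
  unfolding skorokhod_close_def by (meson order_trans)

lemma istopology_skorokhod_open: "istopology (skorokhod_open a b)"
  unfolding istopology_def
proof (intro conjI allI impI)
  fix S T :: "(real \<Rightarrow> real ^ 'd) set"
  assume S: "skorokhod_open a b S" and T: "skorokhod_open a b T"
  show "skorokhod_open a b (S \<inter> T)"
    unfolding skorokhod_open_def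
  proof (intro conjI ballI)
    show "S \<inter> T \<subseteq> skorokhod_space a b"
      using S unfolding skorokhod_open_def by blast
    fix x assume x: "x \<in> S \<inter> T"
    obtain e1 where e1: "e1 > 0"
        "\<forall>y\<in>skorokhod_space a b. skorokhod_close a b e1 x y \<longrightarrow> y \<in> S"
      using S x unfolding skorokhod_open_def by blast
    obtain e2 where e2: "e2 > 0"
        "\<forall>y\<in>skorokhod_space a b. skorokhod_close a b e2 x y \<longrightarrow> y \<in> T"
      using T x unfolding skorokhod_open_def by blast
    have "min e1 e2 > 0 \<and>
        (\<forall>y\<in>skorokhod_space a b. skorokhod_close a b (min e1 e2) x y \<longrightarrow> y \<in> S \<inter> T)"
      using e1 e2 skorokhod_close_mono[of a b "min e1 e2" x] by auto
    then show "\<exists>e>0. \<forall>y\<in>skorokhod_space a b. skorokhod_close a b e x y \<longrightarrow> y \<in> S \<inter> T"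
      by blast
  qed
next
  fix \<K> :: "(real \<Rightarrow> real ^ 'd) set set"
  assume "\<forall>S\<in>\<K>. skorokhod_open a b S"
  then show "skorokhod_open a b (\<Union>\<K>)"
    unfolding skorokhod_open_def by (fast dest: bspec)
qed

lemma openin_skorokhod_topology: "openin (skorokhod_topology a b) = skorokhod_open a b"
  by (simp add: skorokhod_topology_def istopology_skorokhod_open topology_inverse')

definition skorokhod_borel :: "real \<Rightarrow> real \<Rightarrow> (real \<Rightarrow> real ^ 'd) measure" where
  "skorokhod_borel a b = sigma (skorokhod_space a b) {U. openin (skorokhod_topology a b) U}"


subsection \<open>Algorithms\<close>

text \<open>An algorithm uses \<open>2 i\<close> evaluations, \<open>i = npairs\<close>, at the deterministic times \<open>t\<^sub>j = dtime j\<close>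
  and the random times \<open>\<theta>\<^sub>j = rtime j\<close>, \<open>1 \<le> j \<le> i\<close>. A vector in \<open>\<real>\<^bsup>(2 m + 1) d\<^esup>\<close> is represented by
  two families in \<open>\<real>\<^sup>d\<close>, indexed by \<open>{1..m}\<close> and equal to \<open>undefined\<close> elsewhere, and an element
  of \<open>\<real>\<^sup>d\<close>.\<close>

record ('w, 'd :: finite) algorithm =
  npairs :: nat
  dtime :: "nat \<Rightarrow> real"
  rtime :: "nat \<Rightarrow> 'w \<Rightarrow> real"
  next_points :: "nat \<Rightarrow> (nat \<Rightarrow> real ^ 'd) \<times> (nat \<Rightarrow> real ^ 'd) \<times> (real ^ 'd)
                    \<Rightarrow> (real ^ 'd) \<times> (real ^ 'd)"  \<comment> \<open>the maps \<open>\<psi>\<^sub>j\<close>\<close>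
  final_map :: "(real ^ 'd) \<times> (nat \<Rightarrow> real ^ 'd) \<times> (nat \<Rightarrow> real ^ 'd)
                    \<Rightarrow> real \<Rightarrow> real ^ 'd"  \<comment> \<open>the map \<open>\<phi>\<close>\<close>

primrec evaluations :: "('w, 'd) algorithm \<Rightarrow> (real ^ 'd) \<times> 'd rhs \<Rightarrow> 'w \<Rightarrow> nat
    \<Rightarrow> (nat \<Rightarrow> real ^ 'd) \<times> (nat \<Rightarrow> real ^ 'd)" where
  "evaluations A D \<omega> 0 = (\<lambda>_. undefined, \<lambda>_. undefined)"
| "evaluations A D \<omega> (Suc j) =
     (let (u, v) = evaluations A D \<omega> j;
          (y, z) = next_points A (Suc j) (u, v, fst D)
      in (u(Suc j := snd D (dtime A (Suc j), y)), v(Suc j := snd D (rtime A (Suc j) \<omega>, z))))"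

definition information :: "('w, 'd) algorithm \<Rightarrow> (real ^ 'd) \<times> 'd rhs \<Rightarrow> 'w
    \<Rightarrow> (real ^ 'd) \<times> (nat \<Rightarrow> real ^ 'd) \<times> (nat \<Rightarrow> real ^ 'd)" where
  "information A D \<omega> = (fst D, evaluations A D \<omega> (npairs A))"

definition alg_output :: "('w, 'd) algorithm \<Rightarrow> (real ^ 'd) \<times> 'd rhs \<Rightarrow> 'w \<Rightarrow> real \<Rightarrow> real ^ 'd" where
  "alg_output A D \<omega> = final_map A (information A D \<omega>)"

text \<open>\<open>\<theta>\<^sub>j\<close> is required to be a random time for all \<open>j \<le> n\<close> and not just for \<open>j \<le> i\<close>, so that the
  sigma-algebras \<open>\<F>\<^sub>1, \<dots>, \<F>\<^sub>n\<close> below are all defined. The algorithm itself evaluates at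
  \<open>\<theta>\<^sub>1, \<dots>, \<theta>\<^sub>i\<close> only; the choice \<open>\<theta>\<^sub>j = a\<close> for \<open>j > i\<close> gives \<open>\<F>\<^sub>j = \<F>\<^sub>i\<close>. The case \<open>i = 0\<close> is
  included, as otherwise the class would be empty for \<open>n = 1\<close>.\<close>

definition algorithms ::
    "'w measure \<Rightarrow> real \<Rightarrow> real \<Rightarrow> nat \<Rightarrow> ('w, 'd :: finite) algorithm set" where
  "algorithms M a b n = {A.
     2 * npairs A \<le> n \<and>
     (\<forall>j\<in>{1..npairs A}. dtime A j \<in> {a..b}) \<and>
     (\<forall>j\<in>{1..n}. rtime A j \<in> borel_measurable M \<and> (\<forall>\<omega>\<in>space M. rtime A j \<omega> \<in> {a..b})) \<and>
     (\<forall>j\<in>{1..npairs A}. next_points A j \<in> borel_measurable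
        (Pi\<^sub>M {1..<j} (\<lambda>_. borel) \<Otimes>\<^sub>M Pi\<^sub>M {1..<j} (\<lambda>_. borel) \<Otimes>\<^sub>M borel)) \<and>
     final_map A \<in> measurable
        (borel \<Otimes>\<^sub>M Pi\<^sub>M {1..npairs A} (\<lambda>_. borel) \<Otimes>\<^sub>M Pi\<^sub>M {1..npairs A} (\<lambda>_. borel))
        (skorokhod_borel a b)}"

definition alg_filtration :: "'w measure \<Rightarrow> ('w, 'd :: finite) algorithm \<Rightarrow> nat \<Rightarrow> 'w measure" where
  "alg_filtration M A j = sigma (space M)
     ({rtime A k -` B \<inter> space M | k B. k \<in> {1..j} \<and> B \<in> sets borel} \<union> null_sets M)"


subsection \<open>Conditional expectation and error\<close>

definition vec_cond_exp :: "'w measure \<Rightarrow> 'w measure \<Rightarrow> ('w \<Rightarrow> real ^ 'd) \<Rightarrow> 'w \<Rightarrow> real ^ 'd" where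
  "vec_cond_exp M G X \<omega> = (\<chi> k. real_cond_exp M G (\<lambda>\<omega>. X \<omega> $ k) \<omega>)"

text \<open>The supremum is finite for a solution \<open>z\<close> and a path \<open>x\<close> in the Skorokhod space.\<close>

definition sup_error :: "real \<Rightarrow> real \<Rightarrow> (real \<Rightarrow> real ^ 'd) \<Rightarrow> (real \<Rightarrow> real ^ 'd) \<Rightarrow> real" where
  "sup_error a b z x = (SUP t\<in>{a..b}. one_norm (z t - x t))"

text \<open>The right-hand sides \<open>f\<close> themselves are not assumed to be measurable, so the output of an
  algorithm need not be a measurable function of \<open>\<omega>\<close>. Probabilities of error events are
  therefore expressed by \<open>outer_measure_of\<close>, which agrees with the measure on measurable sets
  (in contrast to \<open>measure\<close>, which is \<open>0\<close> on non-measurable sets).\<close>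

end

theory Submission
  imports Defs
begin

text \<open>Each component of \<open>(E\<^sub>j)\<close> is a martingale difference sequence bounded by
  \<open>c = C\<^sub>0 h\<^bsup>\<gamma> + 1/2\<^esup>\<close>, and \<open>n c\<^sup>2 = C\<^sub>0\<^sup>2 (b - a) h\<^bsup>2 \<gamma>\<^esup>\<close> because \<open>n h = b - a\<close>. A maximal
  Azuma-Hoeffding inequality therefore gives Gaussian tails for the maximal partial sum on the
  scale \<open>h\<^bsup>\<gamma>\<^esup>\<close>. For \<open>\<xi> \<ge> 2 (C\<^sub>2 + C\<^sub>3)\<close> the deterministic part of the error is at most half of
  \<open>\<xi> max(h\<^bsup>\<gamma>\<^esup>, \<delta>)\<close>, so that the maximal partial sum has to account for the other half, and for
  large \<open>\<xi>\<close> the factor \<open>2 d\<close> of the union bound is absorbed by halving the exponent.\<close>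

section \<open>Elementary inequalities for exponentials, one norms and stopped sums\<close>

text \<open>This is the auxiliary inequality of Hoeffding's lemma for the symmetric two-point
  distribution on -u and u, whose moment generating function at 1 is \<open>cosh u\<close>. Passing
  to the absolute value meets the sign condition of that inequality and is harmless because
  \<open>cosh\<close> is even.\<close>

lemma cosh_le_exp_half_square: "cosh u \<le> exp (u\<^sup>2 / 2)" for u :: real
proof -
  define v where "v = \<bar>u\<bar>"
  have "- v + ln (1 + (1 / 2) * (exp (2 * v) - 1)) \<le> v\<^sup>2 / 2"
    using Hoeffdings_lemma_aux[of "2 * v" "1 / 2"] by (simp add: v_def power2_eq_square)
  moreover have "1 + (1 / 2) * (exp (2 * v) - 1) = exp v * cosh v"
    by (simp add: cosh_field_def field_simps flip: exp_add)
  ultimately have "ln (cosh v) \<le> v\<^sup>2 / 2"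
    by (simp add: ln_mult)
  then have "cosh v \<le> exp (v\<^sup>2 / 2)"
    by (metis cosh_real_pos exp_le_cancel_iff exp_ln)
  then show ?thesis
    by (simp add: v_def)
qed

text \<open>By convexity the exponential lies below its chord over the interval from
  \<open>- c\<close> to \<open>c\<close>. The chord is split into a constant and a multiple of
  \<open>x\<close>, so that the second term vanishes in expectation when \<open>x\<close> is a
  martingale difference.\<close>

lemma exp_le_cosh_sinh_chord:
  fixes s c x :: real
  assumes "s \<ge> 0" "c > 0" "\<bar>x\<bar> \<le> c"
  shows "exp (s * x) \<le> cosh (s * c) + sinh (s * c) / c * x"
proof -
  define t where "t = (1 + x / c) / 2"
  have t: "0 \<le> t" "t \<le> 1"
    using assms by (auto simp: t_def field_simps)
  have "exp (s * ((1 - t) *\<^sub>R (- c) + t *\<^sub>R c)) \<le> (1 - t) * exp (s * - c) + t * exp (s * c)"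
    using t assms by (intro convex_onD[OF convex_on_exp]) auto
  also have "(1 - t) *\<^sub>R (- c) + t *\<^sub>R c = x"
    using assms by (simp add: t_def field_simps)
  also have "(1 - t) * exp (s * - c) + t * exp (s * c) = cosh (s * c) + sinh (s * c) / c * x"
    using assms by (simp add: t_def cosh_field_def sinh_field_def field_simps)
  finally show ?thesis .
qed

lemma abs_component_le_one_norm: "\<bar>x $ k\<bar> \<le> one_norm x"
  unfolding one_norm_def by (intro member_le_sum) auto

lemma one_norm_gt_imp_component_gt:
  fixes x :: "real ^ ('d :: finite)"
  assumes "one_norm x > r"
  shows "\<exists>k. \<bar>x $ k\<bar> > r / real CARD('d)"
proof (rule ccontr)
  assume "\<not> ?thesis"
  then have "one_norm x \<le> (\<Sum>k\<in>(UNIV :: 'd set). r / real CARD('d))"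
    unfolding one_norm_def by (intro sum_mono) (simp add: not_less)
  with assms show False
    by simp
qed

text \<open>The weights are 1 up to and including the first index \<open>m\<close> whose partial sum
  reaches \<open>r\<close>, and 0 from then on. The weighted sum is therefore the partial sum at
  \<open>m\<close>. The condition on index \<open>j\<close> looks only at indices below
  \<open>j\<close>, so the step that reaches \<open>r\<close> is still counted and the weights stay
  predictable.\<close>

lemma sum_stopped_ge:
  fixes x :: "nat \<Rightarrow> real"
  assumes "k \<in> {1..n}" "(\<Sum>l=1..k. x l) \<ge> r"
  shows "(\<Sum>j=1..n. of_bool (\<forall>i\<in>{1..<j}. (\<Sum>l=1..i. x l) < r) * x j) \<ge> r"
proof -
  define Q where "Q = (\<lambda>k. k \<in> {1..n} \<and> (\<Sum>l=1..k. x l) \<ge> r)"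
  define m where "m = Least Q"
  have "Q k"
    using assms by (simp add: Q_def)
  then have "Q m"
    unfolding m_def by (rule LeastI)
  then have m: "m \<in> {1..n}" "(\<Sum>l=1..m. x l) \<ge> r"
    by (auto simp: Q_def)
  have less: "(\<Sum>l=1..i. x l) < r" if "i \<in> {1..<m}" for i
  proof -
    have "\<not> Q i"
      using that not_less_Least[of i Q] by (simp add: m_def)
    then show ?thesis
      using that m(1) by (auto simp: Q_def)
  qed
  have "(\<Sum>j=1..n. of_bool (\<forall>i\<in>{1..<j}. (\<Sum>l=1..i. x l) < r) * x j) = (\<Sum>j=1..m. x j)"
  proof (rule sum.mono_neutral_cong_right)
    show "\<forall>j\<in>{1..n} - {1..m}. of_bool (\<forall>i\<in>{1..<j}. (\<Sum>l=1..i. x l) < r) * x j = 0"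
    proof
      fix j assume "j \<in> {1..n} - {1..m}"
      with m have "m \<in> {1..<j}" "\<not> (\<Sum>l=1..m. x l) < r"
        by auto
      then have "\<not> (\<forall>i\<in>{1..<j}. (\<Sum>l=1..i. x l) < r)"
        by blast
      then show "of_bool (\<forall>i\<in>{1..<j}. (\<Sum>l=1..i. x l) < r) * x j = 0"
        by (simp only: of_bool_eq mult_zero_left simp_thms)
    qed
    show "of_bool (\<forall>i\<in>{1..<j}. (\<Sum>l=1..i. x l) < r) * x j = x j" if "j \<in> {1..m}" for j
    proof -
      have "\<forall>i\<in>{1..<j}. (\<Sum>l=1..i. x l) < r"
        using less that by simp
      then show ?thesis
        by simp
    qed
  qed (use m(1) in auto)
  with m show ?thesis
    by simp
qed

section \<open>Azuma-Hoeffding inequalities for bounded martingale differences\<close>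

text \<open>The horizon \<open>n\<close> is finite because an algorithm supplies sigma-algebras only
  up to \<open>n\<close>. As a locale the hypotheses can be instantiated again, with the stopped and
  with the negated differences.\<close>

locale bounded_martingale_differences = prob_space M
  for M :: "'w measure" +
  fixes \<F> :: "nat \<Rightarrow> 'w measure" and X :: "nat \<Rightarrow> 'w \<Rightarrow> real" and c :: real and n :: nat
  assumes subalgebra: "j \<le> n \<Longrightarrow> subalgebra M (\<F> j)"
    and sets_filtration_mono: "i \<le> j \<Longrightarrow> j \<le> n \<Longrightarrow> sets (\<F> i) \<subseteq> sets (\<F> j)"
    and adapted: "j \<in> {1..n} \<Longrightarrow> X j \<in> borel_measurable (\<F> j)"
    and cond_exp_zero: "j \<in> {1..n} \<Longrightarrow> AE \<omega> in M. real_cond_exp M (\<F> (j - 1)) (X j) \<omega> = 0"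
    and bounded: "j \<in> {1..n} \<Longrightarrow> AE \<omega> in M. \<bar>X j \<omega>\<bar> \<le> c"
    and bound_pos: "c > 0"
begin

lemma space_filtration: "j \<le> n \<Longrightarrow> space (\<F> j) = space M"
  using subalgebra by (simp add: subalgebra_def)

lemma adapted_later:
  assumes "i \<in> {1..j}" "j \<le> n"
  shows "X i \<in> borel_measurable (\<F> j)"
proof -
  have "subalgebra (\<F> j) (\<F> i)"
    using assms sets_filtration_mono[of i j] space_filtration[of i] space_filtration[of j]
    by (auto simp: subalgebra_def)
  then show ?thesis
    by (rule measurable_from_subalg) (use adapted[of i] assms in auto)
qed

lemma partial_sum_adapted:
  "k \<le> j \<Longrightarrow> j \<le> n \<Longrightarrow> (\<lambda>\<omega>. \<Sum>i=1..k. X i \<omega>) \<in> borel_measurable (\<F> j)"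
  by (intro borel_measurable_sum adapted_later) auto

lemma borel_measurable_difference: "j \<in> {1..n} \<Longrightarrow> X j \<in> borel_measurable M"
  using measurable_from_subalg[OF subalgebra adapted] by simp

lemma partial_sum_measurable:
  "k \<le> n \<Longrightarrow> (\<lambda>\<omega>. \<Sum>i=1..k. X i \<omega>) \<in> borel_measurable M"
  using measurable_from_subalg[OF subalgebra partial_sum_adapted] by blast

lemma sigma_finite_subalgebra: "j \<le> n \<Longrightarrow> sigma_finite_subalgebra M (\<F> j)"
  using subalgebra finite_measure_axioms
  by (intro finite_measure_subalgebra_is_sigma_finite)
     (simp add: finite_measure_subalgebra_def finite_measure_subalgebra_axioms_def)

lemma AE_partial_sum_bounded:
  assumes "k \<le> n"
  shows "AE \<omega> in M. \<bar>\<Sum>i=1..k. X i \<omega>\<bar> \<le> real k * c"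
proof -
  have "AE \<omega> in M. \<forall>i\<in>{1..k}. \<bar>X i \<omega>\<bar> \<le> c"
    using assms bounded by (intro AE_finite_allI) auto
  then show ?thesis
  proof eventually_elim
    case (elim \<omega>)
    have "\<bar>\<Sum>i=1..k. X i \<omega>\<bar> \<le> (\<Sum>i=1..k. \<bar>X i \<omega>\<bar>)"
      by (rule sum_abs)
    also have "\<dots> \<le> (\<Sum>i=1..k. c)"
      using elim by (intro sum_mono) auto
    finally show ?case
      by simp
  qed
qed

lemma integrable_exp_partial_sum:
  assumes "k \<le> n" "s \<ge> 0"
  shows "integrable M (\<lambda>\<omega>. exp (s * (\<Sum>i=1..k. X i \<omega>)))"
proof (rule integrable_const_bound)
  show "AE \<omega> in M. norm (exp (s * (\<Sum>i=1..k. X i \<omega>))) \<le> exp (s * (real k * c))"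
    using AE_partial_sum_bounded[OF assms(1)]
    by eventually_elim (use assms in \<open>auto intro!: mult_left_mono\<close>)
  show "(\<lambda>\<omega>. exp (s * (\<Sum>i=1..k. X i \<omega>))) \<in> borel_measurable M"
    using partial_sum_measurable[OF assms(1)] by measurable
qed

text \<open>The exponential of the first \<open>k\<close> differences is measurable with respect to
  \<open>\<F> k\<close>, so in the expectation \<open>X (Suc k)\<close> may be replaced by its
  conditional expectation, which is 0.\<close>

lemma
  assumes "Suc k \<le> n" "s \<ge> 0"
  shows integrable_exp_partial_sum_mult:
      "integrable M (\<lambda>\<omega>. exp (s * (\<Sum>i=1..k. X i \<omega>)) * X (Suc k) \<omega>)"
    and expectation_exp_partial_sum_mult:
      "expectation (\<lambda>\<omega>. exp (s * (\<Sum>i=1..k. X i \<omega>)) * X (Suc k) \<omega>) = 0"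
proof -
  interpret sigma_finite_subalgebra M "\<F> k"
    using assms by (intro sigma_finite_subalgebra) simp
  let ?Z = "\<lambda>\<omega>. exp (s * (\<Sum>i=1..k. X i \<omega>))"
  have meas: "?Z \<in> borel_measurable (\<F> k)" "X (Suc k) \<in> borel_measurable M"
    using partial_sum_adapted[of k k] borel_measurable_difference[of "Suc k"] assms by auto
  show int: "integrable M (\<lambda>\<omega>. ?Z \<omega> * X (Suc k) \<omega>)"
  proof (rule Bochner_Integration.integrable_bound)
    show "integrable M (\<lambda>\<omega>. ?Z \<omega> * c)"
      using integrable_exp_partial_sum[of k s] assms by simp
    show "(\<lambda>\<omega>. ?Z \<omega> * X (Suc k) \<omega>) \<in> borel_measurable M"
      using meas(2) measurable_from_subalg[OF subalg meas(1)] by measurable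
    have "AE \<omega> in M. \<bar>X (Suc k) \<omega>\<bar> \<le> c"
      using bounded[of "Suc k"] assms by simp
    then show "AE \<omega> in M. norm (?Z \<omega> * X (Suc k) \<omega>) \<le> norm (?Z \<omega> * c)"
      by eventually_elim (use bound_pos in \<open>simp add: abs_mult\<close>)
  qed
  have "expectation (\<lambda>\<omega>. ?Z \<omega> * X (Suc k) \<omega>)
      = expectation (\<lambda>\<omega>. ?Z \<omega> * real_cond_exp M (\<F> k) (X (Suc k)) \<omega>)"
    using real_cond_exp_intg(2)[OF int meas] by simp
  also have "\<dots> = expectation (\<lambda>_. 0)"
    using cond_exp_zero[of "Suc k"] assms
      measurable_from_subalg[OF subalg meas(1)] borel_measurable_cond_exp2[of M "\<F> k" "X (Suc k)"]
    by (intro integral_cong_AE borel_measurable_times) (auto elim: eventually_mono)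
  finally show "expectation (\<lambda>\<omega>. ?Z \<omega> * X (Suc k) \<omega>) = 0"
    by simp
qed

text \<open>Each further difference costs at most a factor \<open>cosh (s * c)\<close>: bound its
  exponential by the chord, multiply by the exponential of the past, and integrate; the linear term
  has expectation 0.\<close>

lemma expectation_exp_partial_sum_le:
  assumes "k \<le> n" "s \<ge> 0"
  shows "expectation (\<lambda>\<omega>. exp (s * (\<Sum>i=1..k. X i \<omega>))) \<le> cosh (s * c) ^ k"
  using assms(1)
proof (induction k)
  case 0
  then show ?case
    by (simp add: prob_space)
next
  case (Suc k)
  let ?Z = "\<lambda>\<omega>. exp (s * (\<Sum>i=1..k. X i \<omega>))"
  have intZ: "integrable M ?Z" and intZX: "integrable M (\<lambda>\<omega>. ?Z \<omega> * X (Suc k) \<omega>)"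
    using Suc.prems assms(2) integrable_exp_partial_sum[of k s] integrable_exp_partial_sum_mult[of k s]
    by auto
  have "AE \<omega> in M. \<bar>X (Suc k) \<omega>\<bar> \<le> c"
    using bounded[of "Suc k"] Suc.prems by simp
  then have "AE \<omega> in M. exp (s * (\<Sum>i=1..Suc k. X i \<omega>))
      \<le> cosh (s * c) * ?Z \<omega> + sinh (s * c) / c * (?Z \<omega> * X (Suc k) \<omega>)"
  proof eventually_elim
    case (elim \<omega>)
    have "exp (s * (\<Sum>i=1..Suc k. X i \<omega>)) = ?Z \<omega> * exp (s * X (Suc k) \<omega>)"
      by (simp add: distrib_left exp_add)
    also have "\<dots> \<le> ?Z \<omega> * (cosh (s * c) + sinh (s * c) / c * X (Suc k) \<omega>)"
      using elim assms(2) bound_pos by (intro mult_left_mono exp_le_cosh_sinh_chord) auto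
    finally show ?case
      by (simp add: algebra_simps)
  qed
  then have "expectation (\<lambda>\<omega>. exp (s * (\<Sum>i=1..Suc k. X i \<omega>)))
      \<le> expectation (\<lambda>\<omega>. cosh (s * c) * ?Z \<omega> + sinh (s * c) / c * (?Z \<omega> * X (Suc k) \<omega>))"
    using integrable_exp_partial_sum[OF Suc.prems assms(2)] intZ intZX
    by (intro integral_mono_AE) auto
  also have "\<dots> = cosh (s * c) * expectation ?Z"
    using intZ intZX expectation_exp_partial_sum_mult[of k s] Suc.prems assms(2) by simp
  also have "\<dots> \<le> cosh (s * c) * cosh (s * c) ^ k"
    using Suc by (intro mult_left_mono) auto
  finally show ?case
    by simp
qed

lemma Azuma_Hoeffding:
  assumes "n \<ge> 1" "r > 0"
  shows "prob {\<omega>\<in>space M. (\<Sum>i=1..n. X i \<omega>) \<ge> r} \<le> exp (- r\<^sup>2 / (2 * real n * c\<^sup>2))"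
proof -
  \<comment> \<open>This value minimizes the Chernoff exponent
    \<open>real n * (s * c)\<^sup>2 / 2 - s * r\<close> that appears below.\<close>
  define s where "s = r / (real n * c\<^sup>2)"
  have s: "s > 0"
    using assms bound_pos by (simp add: s_def)
  have "{\<omega>\<in>space M. (\<Sum>i=1..n. X i \<omega>) \<ge> r}
      = {\<omega>\<in>space M. exp (s * (\<Sum>i=1..n. X i \<omega>)) \<ge> exp (s * r)}"
    using s by simp
  also have "prob \<dots> \<le> expectation (\<lambda>\<omega>. exp (s * (\<Sum>i=1..n. X i \<omega>))) / exp (s * r)"
    using s by (intro integral_Markov_inequality_measure[where A = "{}"] integrable_exp_partial_sum) auto
  also have "\<dots> \<le> cosh (s * c) ^ n / exp (s * r)"
    using s by (intro divide_right_mono expectation_exp_partial_sum_le) auto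
  also have "\<dots> \<le> exp ((s * c)\<^sup>2 / 2) ^ n / exp (s * r)"
    by (intro divide_right_mono power_mono cosh_le_exp_half_square) auto
  also have "\<dots> = exp (real n * ((s * c)\<^sup>2 / 2) - s * r)"
    by (simp add: exp_diff flip: exp_of_nat_mult)
  also have "real n * ((s * c)\<^sup>2 / 2) - s * r = - r\<^sup>2 / (2 * real n * c\<^sup>2)"
    using assms bound_pos by (simp add: s_def field_simps power2_eq_square)
  finally show ?thesis .
qed

text \<open>Multiplying by a predictable weight with values 0 and 1 is a martingale transform: it
  preserves adaptedness, the bound \<open>c\<close> and the vanishing conditional mean.\<close>

lemma stopped:
  "bounded_martingale_differences M \<F>
    (\<lambda>j \<omega>. of_bool (\<forall>i\<in>{1..<j}. (\<Sum>l=1..i. X l \<omega>) < r) * X j \<omega>) c n"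
proof -
  let ?I = "\<lambda>j \<omega>. of_bool (\<forall>i\<in>{1..<j}. (\<Sum>l=1..i. X l \<omega>) < r) :: real"
  \<comment> \<open>Predictability: the weight at \<open>j\<close> involves partial sums up to
    \<open>j - 1\<close> only.\<close>
  have I: "?I j \<in> borel_measurable (\<F> (j - 1))" if "j \<in> {1..n}" for j
  proof -
    have [measurable]: "(\<lambda>\<omega>. \<Sum>l=1..i. X l \<omega>) \<in> borel_measurable (\<F> (j - 1))"
      if "i \<in> {1..<j}" for i
      using that \<open>j \<in> {1..n}\<close> by (intro partial_sum_adapted) auto
    show ?thesis
      by measurable
  qed
  show ?thesis
  proof
    fix j assume j: "j \<in> {1..n}"
    have "subalgebra (\<F> j) (\<F> (j - 1))"
      using j sets_filtration_mono[of "j - 1" j] space_filtration[of "j - 1"] space_filtration[of j]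
      by (auto simp: subalgebra_def)
    then show "(\<lambda>\<omega>. ?I j \<omega> * X j \<omega>) \<in> borel_measurable (\<F> j)"
      using measurable_from_subalg[OF _ I[OF j]] adapted[OF j] by (intro borel_measurable_times)
    show "AE \<omega> in M. \<bar>?I j \<omega> * X j \<omega>\<bar> \<le> c"
      using bounded[OF j] by eventually_elim (use bound_pos in auto)
    interpret sigma_finite_subalgebra M "\<F> (j - 1)"
      by (rule sigma_finite_subalgebra) (use j in auto)
    have meas: "X j \<in> borel_measurable M"
      using j by (rule borel_measurable_difference)
    have "integrable M (\<lambda>\<omega>. ?I j \<omega> * X j \<omega>)"
    proof (rule integrable_const_bound)
      show "AE \<omega> in M. norm (?I j \<omega> * X j \<omega>) \<le> c"
        using bounded[OF j] by eventually_elim (use bound_pos in auto)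
      show "(\<lambda>\<omega>. ?I j \<omega> * X j \<omega>) \<in> borel_measurable M"
        using meas measurable_from_subalg[OF subalg I[OF j]] by (intro borel_measurable_times)
    qed
    \<comment> \<open>The predictable weight is pulled out of the conditional expectation.\<close>
    from real_cond_exp_mult[OF I[OF j] meas this] cond_exp_zero[OF j]
    show "AE \<omega> in M. real_cond_exp M (\<F> (j - 1)) (\<lambda>\<omega>. ?I j \<omega> * X j \<omega>) \<omega> = 0"
      by eventually_elim simp
  qed (rule subalgebra sets_filtration_mono bound_pos; assumption)+
qed

text \<open>Freezing the partial sums once they reach \<open>r\<close> turns the maximum into the last partial sum.\<close>

lemma maximal_Azuma_Hoeffding:
  assumes "n \<ge> 1" "r > 0"
  shows "prob {\<omega>\<in>space M. \<exists>k\<in>{1..n}. (\<Sum>i=1..k. X i \<omega>) \<ge> r}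
    \<le> exp (- r\<^sup>2 / (2 * real n * c\<^sup>2))"
proof -
  interpret stopped: bounded_martingale_differences M \<F>
    "\<lambda>j \<omega>. of_bool (\<forall>i\<in>{1..<j}. (\<Sum>l=1..i. X l \<omega>) < r) * X j \<omega>" c n
    by (rule stopped)
  let ?S = "\<lambda>\<omega>. \<Sum>j=1..n. of_bool (\<forall>i\<in>{1..<j}. (\<Sum>l=1..i. X l \<omega>) < r) * X j \<omega>"
  have "?S \<in> borel_measurable M"
    by (rule stopped.partial_sum_measurable) simp
  then have "{\<omega>\<in>space M. ?S \<omega> \<ge> r} \<in> sets M"
    by measurable
  then have "prob {\<omega>\<in>space M. \<exists>k\<in>{1..n}. (\<Sum>i=1..k. X i \<omega>) \<ge> r} \<le> prob {\<omega>\<in>space M. ?S \<omega> \<ge> r}"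
    using sum_stopped_ge by (intro finite_measure_mono) blast+
  also have "\<dots> \<le> exp (- r\<^sup>2 / (2 * real n * c\<^sup>2))"
    using assms by (rule stopped.Azuma_Hoeffding)
  finally show ?thesis .
qed

text \<open>Applying the one-sided maximal inequality to the negated differences gives the lower
  tail.\<close>

lemma uminus: "bounded_martingale_differences M \<F> (\<lambda>j \<omega>. - X j \<omega>) c n"
proof
  fix j assume j: "j \<in> {1..n}"
  interpret sigma_finite_subalgebra M "\<F> (j - 1)"
    by (rule sigma_finite_subalgebra) (use j in auto)
  have "integrable M (X j)"
    using bounded[OF j] borel_measurable_difference[OF j] by (intro integrable_const_bound) auto
  from real_cond_exp_cmult[OF this, of "-1"] cond_exp_zero[OF j]
  show "AE \<omega> in M. real_cond_exp M (\<F> (j - 1)) (\<lambda>\<omega>. - X j \<omega>) \<omega> = 0"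
    by eventually_elim simp
  show "(\<lambda>\<omega>. - X j \<omega>) \<in> borel_measurable (\<F> j)"
    using adapted[OF j] by (rule borel_measurable_uminus)
  show "AE \<omega> in M. \<bar>- X j \<omega>\<bar> \<le> c"
    using bounded[OF j] by simp
qed (rule subalgebra sets_filtration_mono bound_pos; assumption)+

lemma maximal_Azuma_Hoeffding_abs:
  assumes "n \<ge> 1" "r > 0"
  shows "prob {\<omega>\<in>space M. \<exists>k\<in>{1..n}. \<bar>\<Sum>i=1..k. X i \<omega>\<bar> \<ge> r}
    \<le> 2 * exp (- r\<^sup>2 / (2 * real n * c\<^sup>2))"
proof -
  interpret uminus: bounded_martingale_differences M \<F> "\<lambda>j \<omega>. - X j \<omega>" c n
    by (rule uminus)
  have [measurable]: "(\<lambda>\<omega>. \<Sum>i=1..k. X i \<omega>) \<in> borel_measurable M" if "k \<in> {1..n}" for k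
    using that by (intro partial_sum_measurable) simp
  let ?A = "{\<omega>\<in>space M. \<exists>k\<in>{1..n}. (\<Sum>i=1..k. X i \<omega>) \<ge> r}"
  let ?B = "{\<omega>\<in>space M. \<exists>k\<in>{1..n}. (\<Sum>i=1..k. - X i \<omega>) \<ge> r}"
  have sets: "?A \<in> sets M" "?B \<in> sets M"
    unfolding sum_negf by measurable
  have abs_ge_iff: "r \<le> \<bar>x\<bar> \<longleftrightarrow> r \<le> x \<or> r \<le> - x" for x :: real
    by auto
  have "{\<omega>\<in>space M. \<exists>k\<in>{1..n}. \<bar>\<Sum>i=1..k. X i \<omega>\<bar> \<ge> r} = ?A \<union> ?B"
    unfolding sum_negf abs_ge_iff by blast
  also have "prob \<dots> \<le> prob ?A + prob ?B"
    using sets by (intro measure_Un_le)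
  also have "\<dots> \<le> 2 * exp (- r\<^sup>2 / (2 * real n * c\<^sup>2))"
    using maximal_Azuma_Hoeffding[OF assms] uminus.maximal_Azuma_Hoeffding[OF assms] by simp
  finally show ?thesis .
qed

end

section \<open>The maximal inequality in the one norm\<close>

text \<open>If the one norm exceeds \<open>r\<close>, then some component exceeds
  \<open>r / real CARD('d)\<close> in absolute value. A union bound over the components and the
  two-sided scalar inequality give the factor \<open>2 * real CARD('d)\<close>.\<close>

lemma maximal_Azuma_Hoeffding_one_norm:
  fixes E :: "nat \<Rightarrow> 'w \<Rightarrow> real ^ ('d :: finite)"
  assumes mds: "\<And>l. bounded_martingale_differences M \<F> (\<lambda>j \<omega>. E j \<omega> $ l) c n"
    and "n \<ge> 1" "r > 0"
  shows "{\<omega>\<in>space M. \<exists>k\<in>{1..n}. one_norm (\<Sum>j=1..k. E j \<omega>) > r} \<in> sets M" (is "?A \<in> _")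
    and "measure M {\<omega>\<in>space M. \<exists>k\<in>{1..n}. one_norm (\<Sum>j=1..k. E j \<omega>) > r}
      \<le> 2 * real CARD('d) * exp (- (r / real CARD('d))\<^sup>2 / (2 * real n * c\<^sup>2))"
proof -
  let ?r = "r / real CARD('d)"
  let ?B = "\<lambda>l. {\<omega>\<in>space M. \<exists>k\<in>{1..n}. \<bar>\<Sum>j=1..k. E j \<omega> $ l\<bar> \<ge> ?r}"
  have [measurable]: "(\<lambda>\<omega>. \<Sum>j=1..k. E j \<omega> $ l) \<in> borel_measurable M" if "k \<in> {1..n}" for k l
    using that bounded_martingale_differences.partial_sum_measurable[OF mds] by simp
  show "?A \<in> sets M"
    unfolding one_norm_def sum_component by measurable
  have B: "?B l \<in> sets M" for l
    by measurable
  interpret finite_measure M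
    using mds by (simp add: bounded_martingale_differences_def prob_space_def)
  have "?A \<subseteq> (\<Union>l. ?B l)"
  proof
    fix \<omega> assume "\<omega> \<in> ?A"
    then obtain k where k: "\<omega> \<in> space M" "k \<in> {1..n}" "one_norm (\<Sum>j=1..k. E j \<omega>) > r"
      by blast
    from one_norm_gt_imp_component_gt[OF k(3)]
    obtain l where "\<bar>\<Sum>j=1..k. E j \<omega> $ l\<bar> \<ge> ?r"
      unfolding sum_component by (auto dest: less_imp_le)
    with k show "\<omega> \<in> (\<Union>l. ?B l)"
      by blast
  qed
  then have "measure M ?A \<le> measure M (\<Union>l. ?B l)"
    using B by (intro finite_measure_mono) auto
  also have "\<dots> \<le> (\<Sum>l\<in>UNIV. measure M (?B l))"
    using B by (intro finite_measure_subadditive_finite) auto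
  also have "\<dots> \<le> (\<Sum>l\<in>(UNIV :: 'd set). 2 * exp (- ?r\<^sup>2 / (2 * real n * c\<^sup>2)))"
    using assms by (intro sum_mono bounded_martingale_differences.maximal_Azuma_Hoeffding_abs) auto
  finally show "measure M ?A \<le> 2 * real CARD('d) * exp (- ?r\<^sup>2 / (2 * real n * c\<^sup>2))"
    by (simp add: mult_ac)
qed

section \<open>The filtration of an algorithm and its scalar martingale differences\<close>

text \<open>The restriction to \<open>j \<le> n\<close> matters: \<open>algorithms\<close> makes the
  random times measurable only up to index \<open>n\<close>.\<close>

lemma subalgebra_alg_filtration:
  assumes "A \<in> algorithms M a b n" "j \<le> n"
  shows "subalgebra M (alg_filtration M A j)"
proof -
  have "{rtime A k -` B \<inter> space M | k B. k \<in> {1..j} \<and> B \<in> sets borel} \<union> null_sets M \<subseteq> sets M"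
    using assms by (auto simp: algorithms_def intro!: measurable_sets[of _ M borel])
  then show ?thesis
    unfolding alg_filtration_def subalgebra_def
    by (auto simp: space_measure_of_conv sets.sigma_sets_subset sets_measure_of_conv)
qed

lemma sets_alg_filtration_mono:
  assumes "i \<le> j"
  shows "sets (alg_filtration M A i) \<subseteq> sets (alg_filtration M A j)"
proof -
  let ?G = "\<lambda>j. {rtime A k -` B \<inter> space M | k B. k \<in> {1..j} \<and> B \<in> sets borel} \<union> null_sets M"
  have G: "?G k \<subseteq> Pow (space M)" for k
    using sets.sets_into_space by auto
  have "?G i \<subseteq> ?G j"
    using assms by fastforce
  then show ?thesis
    unfolding alg_filtration_def sets_measure_of[OF G] by (rule sigma_sets_mono')
qed

text \<open>The conditional expectation of a vector is defined componentwise, and a component is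
  bounded by the one norm, so the vector hypotheses pass to each coordinate with the same constant
  \<open>c\<close>.\<close>

lemma bounded_martingale_differences_component:
  fixes E :: "nat \<Rightarrow> 'w \<Rightarrow> real ^ ('d :: finite)"
  assumes "prob_space M" "A \<in> algorithms M a b n" "c > 0"
    and E: "\<forall>j\<in>{1..n}. E j \<in> borel_measurable (alg_filtration M A j)"
      "\<forall>j\<in>{1..n}. AE \<omega> in M. vec_cond_exp M (alg_filtration M A (j - 1)) (E j) \<omega> = 0"
      "\<forall>j\<in>{1..n}. AE \<omega> in M. one_norm (E j \<omega>) \<le> c"
  shows "bounded_martingale_differences M (alg_filtration M A) (\<lambda>j \<omega>. E j \<omega> $ l) c n"
proof (intro bounded_martingale_differences.intro bounded_martingale_differences_axioms.intro)
  show "prob_space M" "c > 0"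
    by fact+
  show "subalgebra M (alg_filtration M A j)" if "j \<le> n" for j
    using assms(2) that by (rule subalgebra_alg_filtration)
  show "sets (alg_filtration M A i) \<subseteq> sets (alg_filtration M A j)" if "i \<le> j" for i j
    using that by (rule sets_alg_filtration_mono)
  fix j assume j: "j \<in> {1..n}"
  show "(\<lambda>\<omega>. E j \<omega> $ l) \<in> borel_measurable (alg_filtration M A j)"
    using bspec[OF E(1) j]
    by (rule measurable_compose) (intro borel_measurable_continuous_onI continuous_intros)
  show "AE \<omega> in M. real_cond_exp M (alg_filtration M A (j - 1)) (\<lambda>\<omega>. E j \<omega> $ l) \<omega> = 0"
    using bspec[OF E(2) j] by eventually_elim (auto simp: vec_cond_exp_def vec_eq_iff)
  show "AE \<omega> in M. \<bar>E j \<omega> $ l\<bar> \<le> c"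
    using bspec[OF E(3) j] by eventually_elim (use abs_component_le_one_norm order_trans in blast)
qed

section \<open>Outer measure of error events\<close>

text \<open>Here \<open>A\<close> may fail to be measurable. It is covered by \<open>B\<close>
  together with a measurable null set containing the exceptional points, and this cover has the
  measure of \<open>B\<close>.\<close>

lemma outer_measure_of_le_AE:
  assumes "AE \<omega> in M. \<omega> \<in> A \<longrightarrow> \<omega> \<in> B" "A \<subseteq> space M" "B \<in> sets M"
  shows "outer_measure_of M A \<le> emeasure M B"
proof -
  obtain N where N: "{\<omega>\<in>space M. \<not> (\<omega> \<in> A \<longrightarrow> \<omega> \<in> B)} \<subseteq> N" "N \<in> null_sets M"
    using assms(1) by (auto elim!: AE_E intro: null_setsI)
  have "outer_measure_of M A \<le> outer_measure_of M (B \<union> N)"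
    using N(1) assms(2) by (intro outer_measure_of_mono) auto
  also have "\<dots> = emeasure M B"
    using N(2) assms(3) by (subst outer_measure_of_eq) (auto simp: emeasure_Un_null_set)
  finally show ?thesis .
qed

section \<open>The tail bound for the error of the algorithms\<close>

theorem theorem1:
  fixes M :: "'w measure"
    and a b \<delta> \<gamma> C0 C1 C2 C3 :: real
    and K :: "real \<Rightarrow> ('d :: finite) rhs set"
    and F :: "((real ^ 'd) \<times> 'd rhs) set"
    and z :: "(real ^ 'd) \<times> 'd rhs \<Rightarrow> real \<Rightarrow> real ^ 'd"
    and A :: "nat \<Rightarrow> ('w, 'd) algorithm"
    and n\<^sub>0 :: nat
  assumes "prob_space M" and "complete_measure M"
    and "a < b" and "\<delta> \<in> {0..1}"
    and noise: "K \<delta> \<subseteq> borel_rhs a b"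
    and solution: "\<And>P. P \<in> F \<Longrightarrow> ivp_solution a b P (z P)"
    and algs: "\<And>n. n \<ge> 1 \<Longrightarrow> A n \<in> algorithms M a b n"
    and pos: "C0 > 0" "C1 > 0" "C2 > 0" "C3 > 0"
    and bound: "\<And>P P' n h. P \<in> F \<Longrightarrow> P' \<in> noisy_data a b K \<delta> P \<Longrightarrow> n \<ge> 1 \<Longrightarrow> n \<ge> n\<^sub>0 \<Longrightarrow>
      h = (b - a) / real n \<Longrightarrow>
      \<exists>E :: nat \<Rightarrow> 'w \<Rightarrow> (real ^ 'd).
        (\<forall>j\<in>{1..n}. E j \<in> borel_measurable (alg_filtration M (A n) j)) \<and>
        (\<forall>j\<in>{1..n}. AE \<omega> in M. vec_cond_exp M (alg_filtration M (A n) (j - 1)) (E j) \<omega> = 0) \<and>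
        (\<forall>j\<in>{1..n}. AE \<omega> in M. one_norm (E j \<omega>) \<le> C0 * h powr (\<gamma> + 1 / 2)) \<and>
        (AE \<omega> in M. sup_error a b (z P) (alg_output (A n) P' \<omega>)
           \<le> C1 * (MAX k\<in>{1..n}. one_norm (\<Sum>j=1..k. E j \<omega>)) + C2 * h powr \<gamma> + C3 * \<delta>)"
  shows "\<exists>c1 c2. c1 > 0 \<and> c2 > 0 \<and>
    (\<forall>P\<in>F. \<forall>P'\<in>noisy_data a b K \<delta> P. \<forall>n h. n \<ge> 1 \<longrightarrow> n \<ge> n\<^sub>0 \<longrightarrow> h = (b - a) / real n \<longrightarrow>
      (\<forall>\<xi>\<ge>c1. outer_measure_of M
          {\<omega> \<in> space M. sup_error a b (z P) (alg_output (A n) P' \<omega>) > \<xi> * max (h powr \<gamma>) \<delta>}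
        \<le> ennreal (exp (- c2 * \<xi>\<^sup>2))))"
proof -
  interpret prob_space M by fact
  define D where "D = real CARD('d)"
  \<comment> \<open>This is the coefficient of \<open>\<xi>\<^sup>2\<close> in
    \<open>(r / D)\<^sup>2 / (2 * real n * c\<^sup>2)\<close> for the values of \<open>r\<close> and
    \<open>c\<close> chosen below; \<open>n\<close> cancels there.\<close>
  define \<kappa> where "\<kappa> = 1 / (8 * C1\<^sup>2 * D\<^sup>2 * C0\<^sup>2 * (b - a))"
  \<comment> \<open>The first two terms control the deterministic error; the square root ensures
    \<open>2 * D * exp (- (\<kappa> / 2) * \<xi>\<^sup>2) \<le> 1\<close>.\<close>
  define c1 where "c1 = 2 * C2 + 2 * C3 + sqrt (2 * ln (2 * D) / \<kappa>)"
  have D: "D \<ge> 1"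
    by (simp add: D_def Suc_leI)
  have \<kappa>: "\<kappa> > 0"
    using pos \<open>a < b\<close> D by (simp add: \<kappa>_def)
  have sqrt_nonneg: "sqrt (2 * ln (2 * D) / \<kappa>) \<ge> 0"
    using D \<kappa> by simp
  have c1_ge: "2 * C2 + 2 * C3 \<le> c1"
    using sqrt_nonneg by (simp only: c1_def le_add_same_cancel1)
  then have c1: "c1 > 0"
    using pos by linarith
  have absorb: "2 * D * exp (- \<kappa> * \<xi>\<^sup>2) \<le> exp (- (\<kappa> / 2) * \<xi>\<^sup>2)" if "\<xi> \<ge> c1" for \<xi>
  proof -
    have "sqrt (2 * ln (2 * D) / \<kappa>) \<le> \<xi>"
      using that pos by (simp add: c1_def)
    then have "2 * ln (2 * D) / \<kappa> \<le> \<xi>\<^sup>2"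
      by (rule sqrt_le_D)
    then have "ln (2 * D) + - \<kappa> * \<xi>\<^sup>2 \<le> - (\<kappa> / 2) * \<xi>\<^sup>2"
      using \<kappa> by (simp add: field_simps)
    then have "exp (ln (2 * D) + - \<kappa> * \<xi>\<^sup>2) \<le> exp (- (\<kappa> / 2) * \<xi>\<^sup>2)"
      by (simp only: exp_le_cancel_iff)
    then show ?thesis
      unfolding exp_add using D by simp
  qed
  have main: "outer_measure_of M
          {\<omega> \<in> space M. sup_error a b (z P) (alg_output (A n) P' \<omega>) > \<xi> * max (h powr \<gamma>) \<delta>}
        \<le> ennreal (exp (- (\<kappa> / 2) * \<xi>\<^sup>2))"
    if P: "P \<in> F" "P' \<in> noisy_data a b K \<delta> P" and n: "n \<ge> 1" "n \<ge> n\<^sub>0"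
      and h: "h = (b - a) / real n" and \<xi>: "\<xi> \<ge> c1" for P P' n h \<xi>
  proof -
    have "h > 0"
      using h n \<open>a < b\<close> by simp
    define H where "H = h powr \<gamma>"
    define c where "c = C0 * h powr (\<gamma> + 1 / 2)"
    \<comment> \<open>Half of the allowed error on the scale \<open>H\<close>, divided by the factor
      \<open>C1\<close> in front of the maximum.\<close>
    define r where "r = \<xi> * H / (2 * C1)"
    have H: "H > 0" and c: "c > 0" and r: "r > 0"
      using \<open>h > 0\<close> pos \<xi> c1 by (auto simp: H_def c_def r_def)
    have "c = C0 * (H * sqrt h)"
      using \<open>h > 0\<close> by (simp add: c_def H_def powr_add powr_half_sqrt)
    \<comment> \<open>The extra exponent 1/2 becomes a full factor \<open>h\<close> after squaring,
      and \<open>h\<close> times \<open>n\<close> is \<open>b - a\<close>.\<close>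
    then have c_square: "c\<^sup>2 = C0\<^sup>2 * H\<^sup>2 * h"
      using \<open>h > 0\<close> by (simp add: power_mult_distrib)
    obtain E :: "nat \<Rightarrow> 'w \<Rightarrow> real ^ 'd"
      where E: "\<forall>j\<in>{1..n}. E j \<in> borel_measurable (alg_filtration M (A n) j)"
          "\<forall>j\<in>{1..n}. AE \<omega> in M. vec_cond_exp M (alg_filtration M (A n) (j - 1)) (E j) \<omega> = 0"
          "\<forall>j\<in>{1..n}. AE \<omega> in M. one_norm (E j \<omega>) \<le> c"
        and err: "AE \<omega> in M. sup_error a b (z P) (alg_output (A n) P' \<omega>)
           \<le> C1 * (MAX k\<in>{1..n}. one_norm (\<Sum>j=1..k. E j \<omega>)) + C2 * H + C3 * \<delta>"
      using bound[OF P n h] unfolding c_def H_def by blast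
    have mds: "bounded_martingale_differences M (alg_filtration M (A n)) (\<lambda>j \<omega>. E j \<omega> $ l) c n" for l
      using \<open>prob_space M\<close> algs[OF n(1)] c E by (rule bounded_martingale_differences_component)
    let ?B = "{\<omega>\<in>space M. \<exists>k\<in>{1..n}. one_norm (\<Sum>j=1..k. E j \<omega>) > r}"
    have "AE \<omega> in M. \<omega> \<in> {\<omega> \<in> space M.
        sup_error a b (z P) (alg_output (A n) P' \<omega>) > \<xi> * max H \<delta>} \<longrightarrow> \<omega> \<in> ?B"
      using err
    proof (eventually_elim, intro impI)
      fix \<omega>
      let ?m = "MAX k\<in>{1..n}. one_norm (\<Sum>j=1..k. E j \<omega>)"
      assume le: "sup_error a b (z P) (alg_output (A n) P' \<omega>) \<le> C1 * ?m + C2 * H + C3 * \<delta>"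
        and \<omega>: "\<omega> \<in> {\<omega> \<in> space M. sup_error a b (z P) (alg_output (A n) P' \<omega>) > \<xi> * max H \<delta>}"
      have "C2 * H + C3 * \<delta> \<le> C2 * max H \<delta> + C3 * max H \<delta>"
        using pos by (intro add_mono mult_left_mono) auto
      also have "\<dots> = (C2 + C3) * max H \<delta>"
        by (simp add: distrib_right)
      also have "\<dots> \<le> \<xi> / 2 * max H \<delta>"
        using \<xi> c1_ge H by (intro mult_right_mono) auto
      finally have "\<xi> / 2 * max H \<delta> < C1 * ?m"
        using le \<omega> by (simp add: field_simps)
      \<comment> \<open>The threshold is lowered from \<open>max H \<delta>\<close> to
        \<open>H\<close>, the scale of the martingale bound, so that the resulting exponent is free
        of \<open>\<delta>\<close>.\<close>
      moreover have "\<xi> / 2 * H \<le> \<xi> / 2 * max H \<delta>"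
        using \<xi> c1 by (intro mult_left_mono) auto
      ultimately have "r < ?m"
        using pos by (simp add: r_def field_simps)
      then show "\<omega> \<in> ?B"
        \<comment> \<open>As \<open>n\<close> is at least 1, the maximum runs over a nonempty set
          and exceeds \<open>r\<close> exactly when one of its entries does.\<close>
        using \<omega> n(1) by (subst (asm) Max_gr_iff) auto
    qed
    then have "outer_measure_of M
        {\<omega> \<in> space M. sup_error a b (z P) (alg_output (A n) P' \<omega>) > \<xi> * max H \<delta>} \<le> emeasure M ?B"
      using maximal_Azuma_Hoeffding_one_norm(1)[OF mds n(1) r]
      by (intro outer_measure_of_le_AE) auto
    also have "\<dots> = ennreal (measure M ?B)"
      by (rule emeasure_eq_measure)
    also have "\<dots> \<le> ennreal (2 * D * exp (- (r / D)\<^sup>2 / (2 * real n * c\<^sup>2)))"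
      unfolding D_def by (intro ennreal_leI maximal_Azuma_Hoeffding_one_norm(2)[OF mds n(1) r])
    also have "- (r / D)\<^sup>2 / (2 * real n * c\<^sup>2) = - \<kappa> * \<xi>\<^sup>2"
    proof -
      have denominator: "2 * real n * c\<^sup>2 = 2 * C0\<^sup>2 * H\<^sup>2 * (b - a)"
        using n(1) by (simp add: c_square h)
      have "(r / D)\<^sup>2 / (2 * C0\<^sup>2 * H\<^sup>2 * (b - a)) = \<kappa> * \<xi>\<^sup>2"
        using H unfolding r_def \<kappa>_def power_divide power_mult_distrib by simp
      then show ?thesis
        unfolding denominator minus_divide_left[symmetric] by simp
    qed
    also have "ennreal (2 * D * exp (- \<kappa> * \<xi>\<^sup>2)) \<le> ennreal (exp (- (\<kappa> / 2) * \<xi>\<^sup>2))"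
      using absorb[OF \<xi>] by (rule ennreal_leI)
    finally show ?thesis
      unfolding H_def .
  qed
  show ?thesis
    by (rule exI[of _ c1], rule exI[of _ "\<kappa> / 2"], intro conjI ballI allI impI)
       (rule c1, simp add: \<kappa>, (rule main; assumption))
qed

end
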